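(* The invariant $I[g]$ is well defined on $QI(\mathbb{R}_+)$: if $f,g:\mathbb{R}_+\to\mathbb{R}_+$ are quasi-isometries with $[f]=[g]$, and $f^{-1},g^{-1}$ are any quasi-inverses of $f,g$, then the sets $I[f]$ (computed with $f^{-1}$) and $I[g]$ (computed with $g^{-1}$) are equal.
   Context: $\mathbb{R}_+=(0,\infty)$ with the Euclidean metric. A map $f:\mathbb{R}_+\to\mathbb{R}_+$ (not necessarily continuous) is a quasi-isometry if there are $\mu\ge1,\delta\ge0,M>0$ with $\frac1\mu|x-y|-\delta\le|f(x)-f(y)|\le\mu|x-y|+\delta$ for all $x,y$, and every point of $\mathbb{R}_+$ is within distance $M$ of $f(\mathbb{R}_+)$. Two quasi-isometries are equivalent, $f\sim g$, if $\sup_x|f(x)-g(x)|<\infty$; the equivalence classes $[f]$ form a group $QI(\mathbb{R}_+)$ under composition. For a quasi-isometry $g$, $g^{-1}$ denotes a quasi-inverse: a quasi-isometry such that $|g^{-1}(g(x))-x|$ and $|g(g^{-1}(x))-x|$ are bounded uniformly in $x$ (unique up to bounded distance). A sequence $\{x_n\}\subset\mathbb{R}_+$ with $x_n\to\infty$ is coarsely dense at infinity if there are $D>0,T_0>0$ such that for every $t\ge T_0$ there is an index $n$ with $|x_n-t|\le D$. For a quasi-isometry $g$ with quasi-inverse $g^{-1}$ put $$I[g]=\Big\{\lim_{n\to\infty}\tfrac{x_n}{g^{-1}(x_n)} : \{x_n\}\text{ is coarsely dense at infinity and the limit exists}\Big\}.$$ *)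

theory Defs
  imports Complex_Main
begin

text \<open>
  The space of positive reals is the set \<open>{0<..}\<close> of type \<open>real set\<close>. Self-maps of it are
  functions \<open>real \<Rightarrow> real\<close> whose values outside \<open>{0<..}\<close> are arbitrary and never referred to.
\<close>

definition quasi_isometry :: "(real \<Rightarrow> real) \<Rightarrow> bool" where
  "quasi_isometry f \<longleftrightarrow>
     f ` {0<..} \<subseteq> {0<..} \<and>
     (\<exists>\<mu> \<delta> M. \<mu> \<ge> 1 \<and> \<delta> \<ge> 0 \<and> M > 0 \<and>
        (\<forall>x\<in>{0<..}. \<forall>y\<in>{0<..}.
            (1 / \<mu>) * \<bar>x - y\<bar> - \<delta> \<le> \<bar>f x - f y\<bar> \<and> \<bar>f x - f y\<bar> \<le> \<mu> * \<bar>x - y\<bar> + \<delta>) \<and>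
        (\<forall>y\<in>{0<..}. \<exists>x\<in>{0<..}. \<bar>y - f x\<bar> \<le> M))"

definition qi_rel :: "((real \<Rightarrow> real) \<times> (real \<Rightarrow> real)) set" where
  "qi_rel = {(f, g). quasi_isometry f \<and> quasi_isometry g \<and>
                     bdd_above ((\<lambda>x. \<bar>f x - g x\<bar>) ` {0<..})}"

definition qi_class :: "(real \<Rightarrow> real) \<Rightarrow> (real \<Rightarrow> real) set" where
  "qi_class f = qi_rel `` {f}"

definition quasi_inverse :: "(real \<Rightarrow> real) \<Rightarrow> (real \<Rightarrow> real) \<Rightarrow> bool" where
  "quasi_inverse g h \<longleftrightarrow>
     quasi_isometry h \<and>
     (\<exists>C. \<forall>x\<in>{0<..}. \<bar>h (g x) - x\<bar> \<le> C \<and> \<bar>g (h x) - x\<bar> \<le> C)"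

definition coarsely_dense_at_infinity :: "(nat \<Rightarrow> real) \<Rightarrow> bool" where
  "coarsely_dense_at_infinity x \<longleftrightarrow>
     (\<forall>n. x n \<in> {0<..}) \<and> filterlim x at_top sequentially \<and>
     (\<exists>D>0. \<exists>T\<^sub>0>0. \<forall>t\<ge>T\<^sub>0. \<exists>n. \<bar>x n - t\<bar> \<le> D)"

text \<open>
  The set $I[g]$ computed with the quasi-inverse \<open>h\<close> of \<open>g\<close>; its defining formula refers to \<open>g\<close>
  only through \<open>h\<close>. Limits are limits in the reals: since \<open>h\<close> is a quasi-isometry, the ratios are
  eventually bounded, so infinite limits cannot occur.
\<close>

definition qi_invariant :: "(real \<Rightarrow> real) \<Rightarrow> real set" where
  "qi_invariant h =
     {L. \<exists>x. coarsely_dense_at_infinity x \<and> (\<lambda>n. x n / h (x n)) \<longlonglongrightarrow> L}"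

end

theory Submission
  imports Defs
begin

text \<open>
  Quasi-inverses of equivalent quasi-isometries stay within bounded distance of each other:
  \<open>f\<close> sends \<open>f' y\<close> and \<open>g' y\<close> to points near \<open>y\<close>, and the lower quasi-isometry inequality for
  \<open>f\<close> turns this into a bound on \<open>\<bar>f' y - g' y\<bar>\<close> (\<open>quasi_inverses_bounded_distance\<close>). Since a
  quasi-isometry of the positive reals tends to infinity, a bounded perturbation is negligible
  compared with it, so \<open>f' x\<^sub>n / g' x\<^sub>n\<close> tends to \<open>1\<close> along every sequence tending to infinity.
  Hence the ratios \<open>x\<^sub>n / f' x\<^sub>n\<close> and \<open>x\<^sub>n / g' x\<^sub>n\<close> converge to the same limit as soon as one of
  them converges (\<open>qi_invariant_mono\<close>), and the same coarsely dense sequences witness the same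
  elements of the invariant.
\<close>

lemma quasi_isometry_pos: "quasi_isometry h \<Longrightarrow> x > 0 \<Longrightarrow> h x > 0"
  by (auto simp: quasi_isometry_def)

lemma quasi_isometry_lower_bound:
  assumes "quasi_isometry h"
  obtains \<mu> \<delta> where "\<mu> \<ge> 1" "\<delta> \<ge> 0"
    "\<And>x y. x > 0 \<Longrightarrow> y > 0 \<Longrightarrow> \<bar>x - y\<bar> \<le> \<mu> * (\<bar>h x - h y\<bar> + \<delta>)"
proof -
  obtain \<mu> \<delta> where "\<mu> \<ge> 1" "\<delta> \<ge> 0"
    and low: "\<And>x y. x > 0 \<Longrightarrow> y > 0 \<Longrightarrow> (1 / \<mu>) * \<bar>x - y\<bar> - \<delta> \<le> \<bar>h x - h y\<bar>"
    using assms by (auto simp: quasi_isometry_def)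
  have "\<bar>x - y\<bar> \<le> \<mu> * (\<bar>h x - h y\<bar> + \<delta>)" if "x > 0" "y > 0" for x y
    using low[OF that] \<open>\<mu> \<ge> 1\<close> by (simp add: field_simps)
  with \<open>\<mu> \<ge> 1\<close> \<open>\<delta> \<ge> 0\<close> show thesis by (rule that)
qed

text \<open>
  The lower inequality with base point \<open>1\<close> forces \<open>\<bar>h x\<bar>\<close> to grow at least linearly; positivity
  of \<open>h\<close> excludes divergence to \<open>-\<infinity>\<close>.
\<close>

lemma quasi_isometry_at_top:
  assumes "quasi_isometry h"
  shows "filterlim h at_top at_top"
proof -
  obtain \<mu> \<delta> where mu: "\<mu> \<ge> 1"
    and low: "\<And>x y. x > 0 \<Longrightarrow> y > 0 \<Longrightarrow> \<bar>x - y\<bar> \<le> \<mu> * (\<bar>h x - h y\<bar> + \<delta>)"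
    using quasi_isometry_lower_bound[OF assms] by metis
  have "Z \<le> h x" if x: "x \<ge> max 1 (1 + \<mu> * (\<bar>Z\<bar> + h 1 + \<delta>))" for x Z
  proof -
    have "\<mu> * (\<bar>Z\<bar> + h 1 + \<delta>) \<le> \<mu> * (\<bar>h x - h 1\<bar> + \<delta>)"
      using low[of x 1] x by linarith
    hence "\<bar>Z\<bar> + h 1 \<le> \<bar>h x - h 1\<bar>" using mu by simp
    moreover have "h x > 0" "h 1 > 0" using quasi_isometry_pos[OF assms] x by auto
    ultimately show ?thesis by linarith
  qed
  thus ?thesis
    unfolding filterlim_at_top eventually_at_top_linorder by blast
qed

lemma qi_class_eq_bounded_distance:
  assumes "quasi_isometry g" and "qi_class f = qi_class g"
  obtains B where "\<And>x. x > 0 \<Longrightarrow> \<bar>f x - g x\<bar> \<le> B"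
proof -
  have "g \<in> qi_class g"
    using assms(1) by (auto simp: qi_class_def qi_rel_def bdd_above_def)
  with assms(2) have "bdd_above ((\<lambda>x. \<bar>f x - g x\<bar>) ` {0<..})"
    by (auto simp: qi_class_def qi_rel_def)
  thus thesis using that by (auto simp: bdd_above_def)
qed

text \<open>
  Both \<open>f (f' y)\<close> and \<open>f (g' y)\<close> are boundedly close to \<open>y\<close>, the latter because \<open>f (g' y)\<close> is close
  to \<open>g (g' y)\<close>; a quasi-isometry cannot bring points that are far apart close together.
\<close>

lemma quasi_inverses_bounded_distance:
  assumes f: "quasi_isometry f"
    and B: "\<And>x. x > 0 \<Longrightarrow> \<bar>f x - g x\<bar> \<le> B"
    and f': "quasi_inverse f f'" and g': "quasi_inverse g g'"
  obtains K where "\<And>y. y > 0 \<Longrightarrow> \<bar>f' y - g' y\<bar> \<le> K"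
proof -
  obtain \<mu> \<delta> where mu: "\<mu> \<ge> 1"
    and low: "\<And>x y. x > 0 \<Longrightarrow> y > 0 \<Longrightarrow> \<bar>x - y\<bar> \<le> \<mu> * (\<bar>f x - f y\<bar> + \<delta>)"
    using quasi_isometry_lower_bound[OF f] by metis
  obtain C where C: "\<And>y. y > 0 \<Longrightarrow> \<bar>f (f' y) - y\<bar> \<le> C"
    using f' by (auto simp: quasi_inverse_def)
  obtain C' where C': "\<And>y. y > 0 \<Longrightarrow> \<bar>g (g' y) - y\<bar> \<le> C'"
    using g' by (auto simp: quasi_inverse_def)
  have "\<bar>f' y - g' y\<bar> \<le> \<mu> * (C + C' + B + \<delta>)" if y: "y > 0" for y
  proof -
    have pos: "f' y > 0" "g' y > 0"
      using f' g' y quasi_isometry_pos by (auto simp: quasi_inverse_def)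
    have "\<bar>f (f' y) - f (g' y)\<bar> \<le> C + C' + B"
      using C[OF y] C'[OF y] B[OF pos(2)] by linarith
    hence "\<mu> * (\<bar>f (f' y) - f (g' y)\<bar> + \<delta>) \<le> \<mu> * (C + C' + B + \<delta>)"
      using mu by (intro mult_left_mono) auto
    with low[OF pos] show ?thesis by linarith
  qed
  thus thesis by (rule that)
qed

lemma tendsto_ratio_one_if_bounded_distance:
  fixes a b :: "'a \<Rightarrow> real"
  assumes b: "filterlim b at_top F" and K: "\<And>n. \<bar>a n - b n\<bar> \<le> K"
  shows "((\<lambda>n. a n / b n) \<longlongrightarrow> 1) F"
proof -
  have K0: "((\<lambda>n. K / b n) \<longlongrightarrow> 0) F"
    by (rule real_tendsto_divide_at_top[OF tendsto_const b])
  have bpos: "eventually (\<lambda>n. b n > 0) F"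
    using b by (simp add: filterlim_at_top_dense)
  have "((\<lambda>n. (a n - b n) / b n) \<longlongrightarrow> 0) F"
  proof (rule tendsto_0_le[OF K0])
    show "eventually (\<lambda>n. norm ((a n - b n) / b n) \<le> norm (K / b n) * 1) F"
      using bpos
    proof eventually_elim
      case (elim n)
      have "\<bar>a n - b n\<bar> \<le> \<bar>K\<bar>" using K[of n] by linarith
      with elim show ?case by (simp add: divide_right_mono)
    qed
  qed
  from tendsto_add[OF this tendsto_const[of 1]]
  have "((\<lambda>n. (a n - b n) / b n + 1) \<longlongrightarrow> 1) F" by simp
  moreover have "eventually (\<lambda>n. (a n - b n) / b n + 1 = a n / b n) F"
    using bpos by eventually_elim (simp add: field_simps)
  ultimately show ?thesis by (rule Lim_transform_eventually)
qed

lemma qi_invariant_mono: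
  assumes h: "quasi_isometry h" and k: "quasi_isometry k"
    and K: "\<And>y. y > 0 \<Longrightarrow> \<bar>h y - k y\<bar> \<le> K"
  shows "qi_invariant h \<subseteq> qi_invariant k"
proof
  fix L assume "L \<in> qi_invariant h"
  then obtain x where x: "coarsely_dense_at_infinity x"
    and L: "(\<lambda>n. x n / h (x n)) \<longlonglongrightarrow> L"
    by (auto simp: qi_invariant_def)
  have pos: "\<And>n. x n > 0" and x_top: "filterlim x at_top sequentially"
    using x by (auto simp: coarsely_dense_at_infinity_def)
  have "(\<lambda>n. h (x n) / k (x n)) \<longlonglongrightarrow> 1"
    using filterlim_compose[OF quasi_isometry_at_top[OF k] x_top] K[OF pos]
    by (rule tendsto_ratio_one_if_bounded_distance)
  from tendsto_mult[OF L this]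
  have "(\<lambda>n. x n / h (x n) * (h (x n) / k (x n))) \<longlonglongrightarrow> L" by simp
  moreover have "x n / h (x n) * (h (x n) / k (x n)) = x n / k (x n)" for n
    using quasi_isometry_pos[OF h pos[of n]] by simp
  ultimately have "(\<lambda>n. x n / k (x n)) \<longlonglongrightarrow> L" by (simp only:)
  with x show "L \<in> qi_invariant k"
    by (auto simp: qi_invariant_def)
qed

theorem proposition3p1:
  fixes f g f' g' :: "real \<Rightarrow> real"
  assumes "quasi_isometry f" and "quasi_isometry g"
    and "qi_class f = qi_class g"
    and "quasi_inverse f f'" and "quasi_inverse g g'"
  shows "qi_invariant f' = qi_invariant g'"
proof -
  obtain B where "\<And>x. x > 0 \<Longrightarrow> \<bar>f x - g x\<bar> \<le> B"
    using qi_class_eq_bounded_distance[OF assms(2,3)] by metis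
  then obtain K where K: "\<And>y. y > 0 \<Longrightarrow> \<bar>f' y - g' y\<bar> \<le> K"
    using quasi_inverses_bounded_distance[OF assms(1) _ assms(4,5)] by metis
  have "quasi_isometry f'" "quasi_isometry g'"
    using assms(4,5) by (auto simp: quasi_inverse_def)
  thus ?thesis
    using qi_invariant_mono K by (metis abs_minus_commute subset_antisym)
qed

end
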